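(* Let $\{f_n\}_{n\ge 1}$ be any sequence in $\mathrm{Hol}(\mathbb{D},\mathbb{D})$ and let $L_n=f_n\circ f_{n-1}\circ\dots\circ f_1$. Then there exist a sequence $\{\gamma_n\}$ in $\mathrm{Aut}(\mathbb{D})$ and a map $h\in\mathrm{Hol}(\mathbb{D},\mathbb{D})$ such that $\gamma_n^{-1}\circ L_n\to h$. Moreover, $h$ is unique up to left composition by elements of $\mathrm{Aut}(\mathbb{D})$: if $\{\gamma_n\},\{\delta_n\}$ are sequences in $\mathrm{Aut}(\mathbb{D})$ and $h,k\in\mathrm{Hol}(\mathbb{D},\mathbb{D})$ satisfy $\gamma_n^{-1}\circ L_n\to h$ and $\delta_n^{-1}\circ L_n\to k$, then $h=\phi\circ k$ for some $\phi\in\mathrm{Aut}(\mathbb{D})$.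
   Context: $\mathbb{D}$ is the open unit disc. $\mathrm{Hol}(\mathbb{D},\mathbb{D})$ is the space of holomorphic self-maps of $\mathbb{D}$ (constants included), with the compact-open topology, and $\mathrm{Aut}(\mathbb{D})$ is the group of conformal automorphisms of $\mathbb{D}$. The notation $g_n\to g$ means uniform convergence on compact subsets of $\mathbb{D}$, with limit $g$ a self-map of $\mathbb{D}$. The sequence $\{L_n\}$ is called the left iterated function system generated by $\{f_n\}$. *)

theory Defs
  imports "HOL-Complex_Analysis.Complex_Analysis"
begin

(* Self-maps of the disc are total functions on complex; only their values on the disc matter,
   so equality, inverses and limits of such maps are always taken on the disc. *)

abbreviation unit_disc :: "complex set" ("\<D>")
  where "\<D> \<equiv> ball 0 1"

definition hol_self_maps :: "(complex \<Rightarrow> complex) set"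
  where "hol_self_maps = {g. g holomorphic_on \<D> \<and> g ` \<D> \<subseteq> \<D>}"

definition disc_automorphisms :: "(complex \<Rightarrow> complex) set"
  where "disc_automorphisms =
    {g. g holomorphic_on \<D> \<and> bij_betw g \<D> \<D> \<and> inv_into \<D> g holomorphic_on \<D>}"

definition converges_on_compacts ::
    "(nat \<Rightarrow> complex \<Rightarrow> complex) \<Rightarrow> (complex \<Rightarrow> complex) \<Rightarrow> bool"
  where "converges_on_compacts g h \<longleftrightarrow>
    (\<forall>K. compact K \<and> K \<subseteq> \<D> \<longrightarrow> uniform_limit K g h sequentially)"

(* The system is generated by f 1, f 2, ...; the value f 0 is never used, and index 0 is the
   empty composition, so that left_ifs f n = f n o ... o f 1. *)

primrec left_ifs :: "(nat \<Rightarrow> complex \<Rightarrow> complex) \<Rightarrow> nat \<Rightarrow> complex \<Rightarrow> complex"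
  where
    "left_ifs f 0 = id"
  | "left_ifs f (Suc n) = f (Suc n) \<circ> left_ifs f n"

end

theory Submission
  imports Defs
begin

text \<open>
  Existence. Compose \<open>L\<^sub>n\<close> with the Moebius transformation that sends \<open>L\<^sub>n(0)\<close> to \<open>0\<close>, obtaining
  \<open>F\<^sub>n\<close> with \<open>F\<^sub>n(0) = 0\<close>. Then \<open>F\<^bsub>n+1\<^esub> = g \<circ> F\<^sub>n\<close> for a self-map \<open>g\<close> fixing the origin, so by the
  Schwarz lemma \<open>\<bar>F\<^sub>n(z)\<bar>\<close> decreases in \<open>n\<close>, to \<open>u(z)\<close> say. All that remains undetermined is the argument,
  and a rotation takes care of it: fix a point \<open>a\<close> with \<open>u(a) \<noteq> 0\<close> (any point, if \<open>u\<close> vanishes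
  identically) and rotate so that \<open>F\<^sub>n(a) \<ge> 0\<close>. Any two subsequential limits of the rotated
  sequence have modulus \<open>u\<close> and agree at \<open>a\<close>; as a holomorphic function of constant modulus is
  constant, they coincide (\<open>holomorphic_eq_if_norm_eq\<close>). By Montel's theorem a sequence of
  self-maps with only one subsequential limit converges (\<open>converges_if_unique_sublimit\<close>).

  Uniqueness. The transition maps \<open>p\<^sub>n = \<gamma>\<^sub>n\<inverse> \<circ> \<delta>\<^sub>n\<close> and their inverses \<open>q\<^sub>n\<close> carry the
  two normalised sequences into each other. Along a common subsequence \<open>p\<^sub>n \<rightarrow> p\<close> and \<open>q\<^sub>n \<rightarrow> q\<close>,
  whence \<open>h = p \<circ> k\<close> and \<open>k = q \<circ> h\<close>. So \<open>p\<close> and \<open>q\<close> attain values in the open disc, and the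
  maximum principle keeps them from degenerating to unimodular constants; passing to the limit
  in \<open>p\<^sub>n \<circ> q\<^sub>n = id\<close> then shows that they are mutually inverse automorphisms.
\<close>

section \<open>Self-maps and automorphisms of the disc\<close>

lemma hol_self_mapsI:
  assumes "g holomorphic_on \<D>" "\<And>z. z \<in> \<D> \<Longrightarrow> g z \<in> \<D>"
  shows "g \<in> hol_self_maps"
  using assms by (auto simp: hol_self_maps_def)

lemma hol_self_mapsD:
  assumes "g \<in> hol_self_maps"
  shows "g holomorphic_on \<D>" and "z \<in> \<D> \<Longrightarrow> g z \<in> \<D>"
  using assms unfolding hol_self_maps_def by blast+

lemma hol_self_maps_comp:
  assumes "g \<in> hol_self_maps" "h \<in> hol_self_maps"
  shows "g \<circ> h \<in> hol_self_maps"
proof (rule hol_self_mapsI)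
  show "g \<circ> h holomorphic_on \<D>"
    using assms holomorphic_on_compose_gen[of h \<D> g \<D>] by (simp add: hol_self_maps_def)
qed (simp add: hol_self_mapsD(2)[OF assms(1)] hol_self_mapsD(2)[OF assms(2)] del: mem_ball mem_ball_0)

lemma left_ifs_hol_self_maps:
  assumes "\<forall>n\<ge>1. f n \<in> hol_self_maps"
  shows "left_ifs f n \<in> hol_self_maps"
proof (induction n)
  case 0
  show ?case by (rule hol_self_mapsI) auto
next
  case (Suc n)
  with assms have "f (Suc n) \<circ> left_ifs f n \<in> hol_self_maps"
    by (intro hol_self_maps_comp) auto
  then show ?case by (simp only: left_ifs.simps)
qed

lemma disc_automorphismsI:
  assumes g: "g \<in> hol_self_maps" and g': "g' \<in> hol_self_maps"
    and left: "\<And>z. z \<in> \<D> \<Longrightarrow> g' (g z) = z" and right: "\<And>z. z \<in> \<D> \<Longrightarrow> g (g' z) = z"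
  shows "g \<in> disc_automorphisms"
proof -
  have bij: "bij_betw g \<D> \<D>"
    by (rule bij_betw_byWitness[where f' = g'])
       (use left right hol_self_mapsD(2)[OF g] hol_self_mapsD(2)[OF g'] in blast)+
  have "inv_into \<D> g z = g' z" if "z \<in> \<D>" for z
    by (rule inv_into_f_eq[OF bij_betw_imp_inj_on[OF bij] hol_self_mapsD(2)[OF g' that] right[OF that]])
  then have "inv_into \<D> g holomorphic_on \<D>"
    using holomorphic_transform[OF hol_self_mapsD(1)[OF g']] by metis
  with bij hol_self_mapsD(1)[OF g] show ?thesis
    by (simp add: disc_automorphisms_def)
qed

lemma disc_automorphismsD:
  assumes g: "g \<in> disc_automorphisms"
  shows "g \<in> hol_self_maps" and "inv_into \<D> g \<in> hol_self_maps"
    and "z \<in> \<D> \<Longrightarrow> g (inv_into \<D> g z) = z" and "z \<in> \<D> \<Longrightarrow> inv_into \<D> g (g z) = z"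
proof -
  have hol: "g holomorphic_on \<D>" "inv_into \<D> g holomorphic_on \<D>" and bij: "bij_betw g \<D> \<D>"
    using g by (auto simp: disc_automorphisms_def)
  show "g \<in> hol_self_maps"
    using hol(1) bij by (simp add: hol_self_maps_def bij_betw_def)
  show "inv_into \<D> g \<in> hol_self_maps"
    using hol(2) bij_betw_inv_into[OF bij] by (simp add: hol_self_maps_def bij_betw_def)
  show "g (inv_into \<D> g z) = z" if "z \<in> \<D>"
    using bij_betw_inv_into_right[OF bij that] .
  show "inv_into \<D> g (g z) = z" if "z \<in> \<D>"
    using bij_betw_inv_into_left[OF bij that] .
qed

lemma disc_automorphisms_inv:
  assumes "g \<in> disc_automorphisms"
  shows "inv_into \<D> g \<in> disc_automorphisms"
  by (rule disc_automorphismsI[of _ g]) (use disc_automorphismsD[OF assms] in blast)+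

lemma disc_automorphisms_inv_inv:
  assumes "g \<in> disc_automorphisms" "z \<in> \<D>"
  shows "inv_into \<D> (inv_into \<D> g) z = g z"
proof -
  have "inv_into \<D> g (inv_into \<D> (inv_into \<D> g) z) = z"
    using disc_automorphismsD(3)[OF disc_automorphisms_inv[OF assms(1)] assms(2)] .
  moreover have "inv_into \<D> (inv_into \<D> g) z \<in> \<D>"
    using hol_self_mapsD(2)[OF disc_automorphismsD(2)[OF disc_automorphisms_inv[OF assms(1)]] assms(2)] .
  ultimately show ?thesis
    using disc_automorphismsD(3)[OF assms(1)] by metis
qed

lemma Moebius_hol_self_maps:
  assumes "w \<in> \<D>"
  shows "Moebius_function 0 w \<in> hol_self_maps"
  using assms
  by (intro hol_self_mapsI Moebius_function_holomorphic) (auto intro: Moebius_function_norm_lt_1)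

lemma rotated_Moebius_automorphism:
  assumes w: "w \<in> \<D>" and c: "norm c = 1"
  shows "(\<lambda>z. c * Moebius_function 0 w z) \<in> disc_automorphisms"
proof (rule disc_automorphismsI[where g' = "\<lambda>z. Moebius_function 0 (- w) (cnj c * z)"])
  have cc: "c * cnj c = 1" "cnj c * c = 1"
    using c by (simp_all add: complex_norm_square[symmetric] mult.commute[of "cnj c"])
  have rot: "(\<lambda>z. d * z) \<in> hol_self_maps" if "norm d = 1" for d
    by (rule hol_self_mapsI) (use that in \<open>auto intro!: holomorphic_intros simp: norm_mult\<close>)
  show "(\<lambda>z. c * Moebius_function 0 w z) \<in> hol_self_maps"
    using hol_self_maps_comp[OF rot[OF c] Moebius_hol_self_maps[OF w]] by (simp add: o_def)
  show "(\<lambda>z. Moebius_function 0 (- w) (cnj c * z)) \<in> hol_self_maps"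
    using hol_self_maps_comp[OF Moebius_hol_self_maps[of "- w"] rot[of "cnj c"]] w c
    by (simp add: o_def)
  fix z assume z: "z \<in> \<D>"
  show "Moebius_function 0 (- w) (cnj c * (c * Moebius_function 0 w z)) = z"
    using Moebius_function_compose[of "- w" w z] w z cc by (simp flip: mult.assoc)
  show "c * Moebius_function 0 w (Moebius_function 0 (- w) (cnj c * z)) = z"
    using Moebius_function_compose[of w "- w" "cnj c * z"] w z cc c
    by (simp add: norm_mult flip: mult.assoc)
qed

section \<open>Normal families of self-maps\<close>

lemma Montel_self_maps:
  assumes G: "\<And>n. G n \<in> hol_self_maps"
  obtains g r where "g holomorphic_on \<D>" "strict_mono (r :: nat \<Rightarrow> nat)"
    "converges_on_compacts (G \<circ> r) g"
proof -
  have "\<exists>B. \<forall>h\<in>hol_self_maps. \<forall>z\<in>K. norm (h z) \<le> B" if "K \<subseteq> \<D>" for K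
  proof (intro exI[of _ 1] ballI)
    fix h z assume "h \<in> hol_self_maps" "z \<in> K"
    then show "norm (h z) \<le> 1"
      using hol_self_mapsD(2)[of h z] that by auto
  qed
  then obtain g and r :: "nat \<Rightarrow> nat" where "g holomorphic_on \<D>" "strict_mono r"
      "\<And>K. \<lbrakk>compact K; K \<subseteq> \<D>\<rbrakk> \<Longrightarrow> uniform_limit K (G \<circ> r) g sequentially"
    using Montel[of \<D> hol_self_maps G] G hol_self_mapsD(1) by (metis image_subsetI open_ball)
  then show thesis
    using that by (simp add: converges_on_compacts_def)
qed

lemma converges_on_compacts_tendsto:
  assumes "converges_on_compacts G g" "z \<in> \<D>"
  shows "(\<lambda>n. G n z) \<longlonglongrightarrow> g z"
proof (rule tendsto_uniform_limitI[where f = G and l = g and x = z])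
  show "uniform_limit {z} G g sequentially"
    by (rule assms(1)[unfolded converges_on_compacts_def, rule_format]) (use assms(2) in simp)
qed simp

lemma converges_on_compacts_subseq:
  assumes "converges_on_compacts G g" "strict_mono (r :: nat \<Rightarrow> nat)"
  shows "converges_on_compacts (G \<circ> r) g"
  using assms filterlim_subseq[OF assms(2)]
  by (auto simp: converges_on_compacts_def o_def intro: filterlim_compose)

lemma converges_on_compacts_cong:
  assumes "\<And>n z. z \<in> \<D> \<Longrightarrow> G n z = H n z"
  shows "converges_on_compacts G g \<longleftrightarrow> converges_on_compacts H g"
proof -
  have "uniform_limit K G g sequentially \<longleftrightarrow> uniform_limit K H g sequentially" if "K \<subseteq> \<D>" for K
    by (rule uniform_limit_cong'[OF assms refl]) (use that in blast)
  then show ?thesis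
    unfolding converges_on_compacts_def by metis
qed

text \<open>Pointwise convergence would not allow the argument to vary with \<open>n\<close>; uniformity on a closed
  disc that contains \<open>w n\<close> for all large \<open>n\<close> does.\<close>

lemma converges_on_compacts_tendsto_at:
  assumes conv: "converges_on_compacts G g" and g: "continuous_on \<D> g"
    and w: "w \<longlonglongrightarrow> l" and l: "l \<in> \<D>"
  shows "(\<lambda>n. G n (w n)) \<longlonglongrightarrow> g l"
proof -
  obtain e where e: "0 < e" "cball l e \<subseteq> \<D>"
    using l open_contains_cball[of \<D>] by blast
  have ev: "\<forall>\<^sub>F n in sequentially. w n \<in> cball l e"
    using w e(1) by (auto simp: tendsto_iff dist_commute intro: eventually_mono less_imp_le)
  have "uniform_limit (cball l e) G g sequentially"
    using conv e(2) by (simp add: converges_on_compacts_def)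
  have "(\<lambda>n. G n (w n) - g (w n)) \<longlonglongrightarrow> 0"
  proof (rule tendstoI)
    fix d :: real assume "0 < d"
    then have "\<forall>\<^sub>F n in sequentially. \<forall>x\<in>cball l e. dist (G n x) (g x) < d"
      using \<open>uniform_limit (cball l e) G g sequentially\<close> by (simp add: uniform_limit_iff)
    with ev show "\<forall>\<^sub>F n in sequentially. dist (G n (w n) - g (w n)) 0 < d"
      by eventually_elim (simp add: dist_norm)
  qed
  moreover have "(\<lambda>n. g (w n)) \<longlonglongrightarrow> g l"
    using isCont_tendsto_compose[OF _ w, of g] g l continuous_on_eq_continuous_at[of \<D> g] by simp
  ultimately show ?thesis
    by (rule Lim_transform[rotated])
qed

text \<open>A limit of self-maps maps into the closed disc. By the maximum principle it meets the unit
  circle only if it is constant, and a single value in the open disc excludes that.\<close>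

lemma limit_hol_self_maps:
  assumes G: "\<And>n. G n \<in> hol_self_maps" and g: "g holomorphic_on \<D>"
    and conv: "converges_on_compacts G g" and a: "a \<in> \<D>" "g a \<in> \<D>"
  shows "g \<in> hol_self_maps"
proof (rule hol_self_mapsI[OF g])
  have le: "norm (g z) \<le> 1" if "z \<in> \<D>" for z
  proof (rule Lim_norm_ubound[OF _ converges_on_compacts_tendsto[OF conv that]])
    show "\<forall>\<^sub>F n in sequentially. norm (G n z) \<le> 1"
      using hol_self_mapsD(2)[OF G that] by (simp add: less_imp_le)
  qed simp
  fix z assume z: "z \<in> \<D>"
  show "g z \<in> \<D>"
  proof (rule ccontr)
    assume "g z \<notin> \<D>"
    with le have "g constant_on \<D>"
      by (intro maximum_modulus_principle[OF g _ _ _ order_refl z])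
         (use order_trans in \<open>auto simp: not_less\<close>)
    with a z \<open>g z \<notin> \<D>\<close> show False
      by (metis constant_on_def)
  qed
qed

lemma converges_if_unique_sublimit:
  assumes G: "\<And>n. G n \<in> hol_self_maps"
    and uniq: "\<And>g r z. \<lbrakk>g holomorphic_on \<D>; strict_mono (r :: nat \<Rightarrow> nat);
                 converges_on_compacts (G \<circ> r) g; z \<in> \<D>\<rbrakk> \<Longrightarrow> g z = h z"
  shows "converges_on_compacts G h"
  unfolding converges_on_compacts_def
proof (intro allI impI, elim conjE, rule ccontr)
  fix K assume K: "compact K" "K \<subseteq> \<D>" and "\<not> uniform_limit K G h sequentially"
  then obtain e where e: "e > 0"
      and "\<not> (\<forall>\<^sub>F n in sequentially. \<forall>x\<in>K. dist (G n x) (h x) < e)"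
    by (auto simp: uniform_limit_iff)
  then have "infinite {n. \<not> (\<forall>x\<in>K. dist (G n x) (h x) < e)}"
    by (simp add: eventually_cofinite flip: cofinite_eq_sequentially)
  then obtain s :: "nat \<Rightarrow> nat" where s: "strict_mono s"
      and far: "\<And>n. \<not> (\<forall>x\<in>K. dist (G (s n) x) (h x) < e)"
    using infinite_enumerate by blast
  obtain g r where g: "g holomorphic_on \<D>" and r: "strict_mono (r :: nat \<Rightarrow> nat)"
      and conv: "converges_on_compacts ((G \<circ> s) \<circ> r) g"
    by (rule Montel_self_maps[of "G \<circ> s"]) (use G in auto)
  have eq: "g z = h z" if "z \<in> \<D>" for z
    using uniq[OF g strict_mono_o[OF s r] _ that] conv by (simp add: o_assoc)
  have "\<forall>\<^sub>F n in sequentially. \<forall>x\<in>K. dist (G (s (r n)) x) (g x) < e"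
    using conv K e by (simp add: converges_on_compacts_def uniform_limit_iff)
  then obtain n where "\<forall>x\<in>K. dist (G (s (r n)) x) (g x) < e"
    by (auto dest: eventually_happens)
  with far[of "r n"] eq K(2) show False
    by (metis subsetD)
qed

section \<open>Rigidity of the modulus\<close>

text \<open>Near \<open>a\<close> the function \<open>h\<close> has no zero and \<open>g / h\<close> has modulus \<open>1\<close>, so this quotient is
  constant by the maximum principle. Its value at \<open>a\<close> is \<open>1\<close>, and the identity theorem does the
  rest.\<close>

lemma holomorphic_eq_if_norm_eq:
  assumes S: "open S" "connected S"
    and g: "g holomorphic_on S" and h: "h holomorphic_on S"
    and norm_eq: "\<And>z. z \<in> S \<Longrightarrow> norm (g z) = norm (h z)"
    and a: "a \<in> S" "g a = h a" "h a \<noteq> 0" and z: "z \<in> S"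
  shows "g z = h z"
proof -
  have "open (S \<inter> h -` (- {0}))"
    by (intro continuous_open_preimage holomorphic_on_imp_continuous_on h S(1)) auto
  moreover have "a \<in> S \<inter> h -` (- {0})"
    using a by simp
  ultimately obtain e where e: "e > 0" "ball a e \<subseteq> S \<inter> h -` (- {0})"
    using open_contains_ball by metis
  define q where "q z = g z / h z" for z
  have "q holomorphic_on ball a e"
    unfolding q_def
    by (intro holomorphic_intros holomorphic_on_subset[OF g] holomorphic_on_subset[OF h])
       (use e(2) in auto)
  then have "q constant_on ball a e"
  proof (rule maximum_modulus_principle[OF _ _ _ _ order_refl])
    have q1: "norm (q w) = 1" if "w \<in> ball a e" for w
    proof -
      have "w \<in> S" "h w \<noteq> 0"
        using e(2) that by auto
      then show ?thesis
        by (simp add: q_def norm_divide norm_eq)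
    qed
    then show "norm (q w) \<le> norm (q a)" if "w \<in> ball a e" for w
      using that e(1) by simp
  qed (use e(1) in auto)
  moreover have "q a = 1"
    using a by (simp add: q_def)
  ultimately have q1: "q w = 1" if "w \<in> ball a e" for w
    using that e(1) unfolding constant_on_def by (metis centre_in_ball)
  show ?thesis
  proof (rule analytic_continuation_open[OF _ S(1) _ S(2) _ g h _ z])
    show "g w = h w" if "w \<in> ball a e" for w
      using q1[OF that] e(2) that by (auto simp: q_def divide_eq_1_iff)
  qed (use e in auto)
qed

section \<open>Existence of the limit\<close>

text \<open>Monotonicity determines the modulus of every subsequential limit; choosing the rotations so
  that the values at one point \<open>a\<close> become nonnegative determines the limit itself, unless the
  limiting modulus vanishes at \<open>a\<close>. The point \<open>a\<close> is chosen so that this happens only if the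
  limiting modulus vanishes everywhere, and then \<open>0\<close> is the only subsequential limit. The bound
  \<open>\<bar>h\<bar> \<le> \<bar>F 0\<bar> < 1\<close> keeps the limit inside the open disc.\<close>

lemma rotations_converge_if_norm_decseq:
  fixes F :: "nat \<Rightarrow> complex \<Rightarrow> complex"
  assumes F: "\<And>n. F n \<in> hol_self_maps"
    and dec: "\<And>z. z \<in> \<D> \<Longrightarrow> decseq (\<lambda>n. norm (F n z))"
  obtains c h where "\<And>n. norm (c n) = 1" "h \<in> hol_self_maps"
    "converges_on_compacts (\<lambda>n z. c n * F n z) h"
proof -
  define u where "u z = lim (\<lambda>n. norm (F n z))" for z
  have u: "(\<lambda>n. norm (F n z)) \<longlonglongrightarrow> u z" if z: "z \<in> \<D>" for z
  proof -
    obtain L where "(\<lambda>n. norm (F n z)) \<longlonglongrightarrow> L"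
      using decseq_convergent[OF dec[OF z], of 0] by auto
    then show ?thesis
      by (simp add: u_def limI)
  qed
  obtain a where a: "a \<in> \<D>" and ua: "u a = 0 \<Longrightarrow> \<forall>z\<in>\<D>. u z = 0"
    by (metis centre_in_ball zero_less_one)
  define c where "c n = (if F n a = 0 then 1 else of_real (norm (F n a)) / F n a)" for n
  have c1: "norm (c n) = 1" and ca: "c n * F n a = of_real (norm (F n a))" for n
    by (auto simp: c_def norm_divide)
  define G where "G n z = c n * F n z" for n z
  have G: "G n \<in> hol_self_maps" for n
    unfolding G_def
    by (rule hol_self_mapsI)
       (use hol_self_mapsD[OF F[of n]] in \<open>auto intro!: holomorphic_intros simp: norm_mult c1\<close>)
  have sublimit: "norm (g z) = u z \<and> g a = of_real (u a)"
    if r: "strict_mono (r :: nat \<Rightarrow> nat)" and g: "converges_on_compacts (G \<circ> r) g" and z: "z \<in> \<D>"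
    for g r z
  proof
    have "(\<lambda>n. norm ((G \<circ> r) n z)) \<longlonglongrightarrow> norm (g z)"
      by (intro tendsto_norm converges_on_compacts_tendsto[OF g z])
    moreover have "(\<lambda>n. norm ((G \<circ> r) n z)) \<longlonglongrightarrow> u z"
      using LIMSEQ_subseq_LIMSEQ[OF u[OF z] r] by (simp add: G_def norm_mult c1 o_def)
    ultimately show "norm (g z) = u z"
      by (rule LIMSEQ_unique)
    have "(\<lambda>n. (G \<circ> r) n a) \<longlonglongrightarrow> of_real (u a)"
      using tendsto_of_real[OF LIMSEQ_subseq_LIMSEQ[OF u[OF a] r]] by (simp add: G_def ca o_def)
    with converges_on_compacts_tendsto[OF g a] show "g a = of_real (u a)"
      by (rule LIMSEQ_unique)
  qed
  obtain h r0 where h: "h holomorphic_on \<D>" and r0: "strict_mono (r0 :: nat \<Rightarrow> nat)"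
      and conv0: "converges_on_compacts (G \<circ> r0) h"
    by (rule Montel_self_maps[of G]) (use G in auto)
  note hlim = sublimit[OF r0 conv0]
  have conv: "converges_on_compacts G h"
  proof (rule converges_if_unique_sublimit[OF G])
    fix g z and r :: "nat \<Rightarrow> nat"
    assume g: "g holomorphic_on \<D>" and r: "strict_mono r"
      and gconv: "converges_on_compacts (G \<circ> r) g" and z: "z \<in> \<D>"
    note glim = sublimit[OF r gconv]
    show "g z = h z"
    proof (cases "u a = 0")
      case True
      then show ?thesis
        using ua glim[OF z] hlim[OF z] z by (metis norm_eq_zero)
    next
      case False
      show ?thesis
      proof (rule holomorphic_eq_if_norm_eq[of \<D> g h a z])
        show "norm (g w) = norm (h w)" if "w \<in> \<D>" for w
          using glim[OF that] hlim[OF that] by simp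
        show "g a = h a" "h a \<noteq> 0"
          using glim[OF a] hlim[OF a] False by auto
      qed (use g h a z in auto)
    qed
  qed
  have "h \<in> hol_self_maps"
  proof (rule hol_self_mapsI[OF h])
    fix z assume z: "z \<in> \<D>"
    have "u z \<le> norm (F 0 z)"
      by (rule decseq_ge[OF dec[OF z] u[OF z]])
    then show "h z \<in> \<D>"
      using hlim[OF z] hol_self_mapsD(2)[OF F z, of 0] by simp
  qed
  with c1 conv show thesis
    using that unfolding G_def by blast
qed

text \<open>With \<open>F\<^sub>n\<close> the normalisation of \<open>L n\<close> that vanishes at \<open>0\<close>, the self-map taking \<open>F\<^sub>n\<close> to
  \<open>F\<^bsub>n+1\<^esub>\<close> fixes \<open>0\<close>, and the Schwarz lemma applies to it.\<close>

lemma normalised_left_ifs_norm_decseq: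
  fixes f :: "nat \<Rightarrow> complex \<Rightarrow> complex"
  assumes f: "\<forall>n\<ge>1. f n \<in> hol_self_maps" and z: "z \<in> \<D>"
  shows "decseq (\<lambda>n. norm (Moebius_function 0 (left_ifs f n 0) (left_ifs f n z)))"
proof (rule decseq_SucI)
  fix n
  let ?L = "left_ifs f"
  have L: "?L m x \<in> \<D>" if "x \<in> \<D>" for m x
    using hol_self_mapsD(2)[OF left_ifs_hol_self_maps[OF f] that] .
  have L0: "?L m 0 \<in> \<D>" for m
    by (rule L) simp
  define g where
    "g = Moebius_function 0 (?L (Suc n) 0) \<circ> (f (Suc n) \<circ> Moebius_function 0 (- ?L n 0))"
  have g: "g \<in> hol_self_maps"
    unfolding g_def
    by (intro hol_self_maps_comp Moebius_hol_self_maps) (use f L0[of n] L0[of "Suc n"] in auto)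
  define x where "x = Moebius_function 0 (?L n 0) (?L n z)"
  have x: "x \<in> \<D>"
    unfolding x_def by (rule hol_self_mapsD(2)[OF Moebius_hol_self_maps[OF L0] L[OF z]])
  have "Moebius_function 0 (- ?L n 0) x = ?L n z"
    unfolding x_def by (rule Moebius_function_compose) (use L0[of n] L[OF z, of n] in auto)
  then have gx: "g x = Moebius_function 0 (?L (Suc n) 0) (?L (Suc n) z)"
    by (simp add: g_def)
  have "g 0 = 0"
    by (simp add: g_def Moebius_function_of_zero Moebius_function_eq_zero)
  then have "norm (g x) \<le> norm x"
    by (intro Schwarz_Lemma(1) hol_self_mapsD(1)[OF g])
       (use hol_self_mapsD(2)[OF g] x in auto)
  then show "norm (Moebius_function 0 (?L (Suc n) 0) (?L (Suc n) z))
      \<le> norm (Moebius_function 0 (?L n 0) (?L n z))"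
    unfolding gx unfolding x_def .
qed

lemma left_ifs_normalisable:
  fixes f :: "nat \<Rightarrow> complex \<Rightarrow> complex"
  assumes f: "\<forall>n\<ge>1. f n \<in> hol_self_maps"
  obtains \<gamma> h where "\<And>n. \<gamma> n \<in> disc_automorphisms" "h \<in> hol_self_maps"
    "converges_on_compacts (\<lambda>n. inv_into \<D> (\<gamma> n) \<circ> left_ifs f n) h"
proof -
  let ?L = "left_ifs f"
  have L: "?L n \<in> hol_self_maps" for n
    by (rule left_ifs_hol_self_maps[OF f])
  have L0: "?L n 0 \<in> \<D>" for n
    by (rule hol_self_mapsD(2)[OF L]) simp
  define F where "F n = Moebius_function 0 (?L n 0) \<circ> ?L n" for n
  have "F n \<in> hol_self_maps" for n
    unfolding F_def by (intro hol_self_maps_comp Moebius_hol_self_maps L L0)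
  moreover have "decseq (\<lambda>n. norm (F n z))" if "z \<in> \<D>" for z
    using normalised_left_ifs_norm_decseq[OF f that] by (simp add: F_def)
  ultimately obtain c h where c: "\<And>n. norm (c n) = 1" and h: "h \<in> hol_self_maps"
      and conv: "converges_on_compacts (\<lambda>n z. c n * F n z) h"
    using rotations_converge_if_norm_decseq[of F] by metis
  define T where "T n z = c n * Moebius_function 0 (?L n 0) z" for n z
  have T: "T n \<in> disc_automorphisms" for n
    unfolding T_def by (rule rotated_Moebius_automorphism[OF L0 c])
  have "converges_on_compacts (\<lambda>n. inv_into \<D> (inv_into \<D> (T n)) \<circ> ?L n) h"
    using conv
  proof (rule converges_on_compacts_cong[THEN iffD1, rotated])
    fix n z assume "z \<in> \<D>"
    then show "c n * F n z = (inv_into \<D> (inv_into \<D> (T n)) \<circ> ?L n) z"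
      using disc_automorphisms_inv_inv[OF T hol_self_mapsD(2)[OF L]] by (simp add: F_def T_def)
  qed
  then show thesis
    using that[of "\<lambda>n. inv_into \<D> (T n)" h] h disc_automorphisms_inv[OF T] by blast
qed

section \<open>Uniqueness of the limit\<close>

text \<open>The automorphisms \<open>P n\<close> need not converge, for instance when \<open>h\<close> and \<open>k\<close> are constant, so
  \<open>\<phi>\<close> is a limit along a subsequence. What prevents the \<open>P n\<close> from running off to the boundary is
  that they carry \<open>B n 0\<close>, which tends to \<open>k 0\<close>, to \<open>A n 0\<close>, which tends to \<open>h 0\<close>, and both limits
  lie in the open disc.\<close>

lemma limits_automorphic:
  assumes PQ: "\<And>n. P n \<in> hol_self_maps" "\<And>n. Q n \<in> hol_self_maps"
      "\<And>n z. z \<in> \<D> \<Longrightarrow> P n (Q n z) = z" "\<And>n z. z \<in> \<D> \<Longrightarrow> Q n (P n z) = z"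
    and B: "\<And>n. B n \<in> hol_self_maps" and A: "\<And>n z. z \<in> \<D> \<Longrightarrow> A n z = P n (B n z)"
    and hk: "h \<in> hol_self_maps" "k \<in> hol_self_maps"
    and conv: "converges_on_compacts A h" "converges_on_compacts B k"
  obtains \<phi> where "\<phi> \<in> disc_automorphisms" "\<And>z. z \<in> \<D> \<Longrightarrow> h z = \<phi> (k z)"
proof -
  obtain p r where p: "p holomorphic_on \<D>" and r: "strict_mono (r :: nat \<Rightarrow> nat)"
      and Pr: "converges_on_compacts (P \<circ> r) p"
    by (rule Montel_self_maps[OF PQ(1)])
  obtain q s where q: "q holomorphic_on \<D>" and s: "strict_mono (s :: nat \<Rightarrow> nat)"
      and Qs: "converges_on_compacts ((Q \<circ> r) \<circ> s) q"
    by (rule Montel_self_maps[of "Q \<circ> r"]) (use PQ(2) in auto)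
  define t where "t = r \<circ> s"
  have t: "strict_mono t"
    unfolding t_def by (rule strict_mono_o[OF r s])
  have Pt: "converges_on_compacts (P \<circ> t) p" and Qt: "converges_on_compacts (Q \<circ> t) q"
    using converges_on_compacts_subseq[OF Pr s] Qs by (simp_all add: t_def o_assoc)
  have lim: "(\<lambda>n. A (t n) z) \<longlonglongrightarrow> h z" "(\<lambda>n. B (t n) z) \<longlonglongrightarrow> k z" if "z \<in> \<D>" for z
    using converges_on_compacts_tendsto[OF converges_on_compacts_subseq[OF conv(1) t] that]
      converges_on_compacts_tendsto[OF converges_on_compacts_subseq[OF conv(2) t] that]
    by (simp_all add: o_def)
  note Plim = converges_on_compacts_tendsto_at[OF Pt holomorphic_on_imp_continuous_on[OF p]]
  note Qlim = converges_on_compacts_tendsto_at[OF Qt holomorphic_on_imp_continuous_on[OF q]]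
  have hpk: "h z = p (k z)" if z: "z \<in> \<D>" for z
    using LIMSEQ_unique[OF lim(1)[OF z]] Plim[OF lim(2)[OF z] hol_self_mapsD(2)[OF hk(2) z]]
      A[OF z] by simp
  have kqh: "k z = q (h z)" if z: "z \<in> \<D>" for z
    using LIMSEQ_unique[OF lim(2)[OF z]] Qlim[OF lim(1)[OF z] hol_self_mapsD(2)[OF hk(1) z]]
      A[OF z] PQ(4)[OF hol_self_mapsD(2)[OF B z]] by simp
  have h0: "h 0 \<in> \<D>" and k0: "k 0 \<in> \<D>"
    using hol_self_mapsD(2)[OF hk(1), of 0] hol_self_mapsD(2)[OF hk(2), of 0] by auto
  have p': "p \<in> hol_self_maps"
    by (rule limit_hol_self_maps[OF _ p Pt k0]) (use PQ(1) h0 hpk[of 0] in auto)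
  have q': "q \<in> hol_self_maps"
    by (rule limit_hol_self_maps[OF _ q Qt h0]) (use PQ(2) k0 kqh[of 0] in auto)
  have "p \<in> disc_automorphisms"
  proof (rule disc_automorphismsI[OF p' q'])
    fix z assume z: "z \<in> \<D>"
    show "q (p z) = z"
      using LIMSEQ_unique[OF Qlim[OF converges_on_compacts_tendsto[OF Pt z] hol_self_mapsD(2)[OF p' z]]]
        PQ(4)[OF z] by simp
    show "p (q z) = z"
      using LIMSEQ_unique[OF Plim[OF converges_on_compacts_tendsto[OF Qt z] hol_self_mapsD(2)[OF q' z]]]
        PQ(3)[OF z] by simp
  qed
  with hpk show thesis
    using that by blast
qed

lemma left_ifs_limit_unique:
  fixes f :: "nat \<Rightarrow> complex \<Rightarrow> complex"
  assumes f: "\<forall>n\<ge>1. f n \<in> hol_self_maps"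
    and \<gamma>: "\<forall>n\<ge>1. \<gamma> n \<in> disc_automorphisms" and \<delta>: "\<forall>n\<ge>1. \<delta> n \<in> disc_automorphisms"
    and hk: "h \<in> hol_self_maps" "k \<in> hol_self_maps"
    and conv: "converges_on_compacts (\<lambda>n. inv_into \<D> (\<gamma> n) \<circ> left_ifs f n) h"
      "converges_on_compacts (\<lambda>n. inv_into \<D> (\<delta> n) \<circ> left_ifs f n) k"
  obtains \<phi> where "\<phi> \<in> disc_automorphisms" "\<And>z. z \<in> \<D> \<Longrightarrow> h z = \<phi> (k z)"
proof -
  \<comment> \<open>Index \<open>0\<close>, where nothing is known about \<open>\<gamma>\<close> and \<open>\<delta>\<close>, is skipped by shifting.\<close>
  define g d L where "g n = \<gamma> (Suc n)" and "d n = \<delta> (Suc n)" and "L n = left_ifs f (Suc n)" for n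
  have g: "g n \<in> disc_automorphisms" and d: "d n \<in> disc_automorphisms"
    and L: "L n \<in> hol_self_maps" for n
    using \<gamma> \<delta> left_ifs_hol_self_maps[OF f] by (simp_all add: g_def d_def L_def del: left_ifs.simps)
  note gD = disc_automorphismsD[OF g] and dD = disc_automorphismsD[OF d]
  have shift: "strict_mono Suc"
    by (simp add: strict_mono_Suc_iff)
  show thesis
  proof (rule limits_automorphic[where P = "\<lambda>n. inv_into \<D> (g n) \<circ> d n"
        and Q = "\<lambda>n. inv_into \<D> (d n) \<circ> g n" and A = "\<lambda>n. inv_into \<D> (g n) \<circ> L n"
        and B = "\<lambda>n. inv_into \<D> (d n) \<circ> L n", OF _ _ _ _ _ _ hk _ _ that])
    show "converges_on_compacts (\<lambda>n. inv_into \<D> (g n) \<circ> L n) h"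
      "converges_on_compacts (\<lambda>n. inv_into \<D> (d n) \<circ> L n) k"
      using conv[THEN converges_on_compacts_subseq, OF shift]
      by (simp_all add: g_def d_def L_def comp_def del: left_ifs.simps)
  next
    fix n z assume z: "z \<in> \<D>"
    show "(inv_into \<D> (g n) \<circ> d n) ((inv_into \<D> (d n) \<circ> g n) z) = z"
      "(inv_into \<D> (d n) \<circ> g n) ((inv_into \<D> (g n) \<circ> d n) z) = z"
      using gD(3,4)[of _ n] dD(3,4)[of _ n] hol_self_mapsD(2)[OF gD(1)[of n] z]
        hol_self_mapsD(2)[OF dD(1)[of n] z] z by (simp_all del: mem_ball mem_ball_0)
    show "(inv_into \<D> (g n) \<circ> L n) z = (inv_into \<D> (g n) \<circ> d n) ((inv_into \<D> (d n) \<circ> L n) z)"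
      using dD(3)[OF hol_self_mapsD(2)[OF L[of n] z], of n] by simp
  qed (intro hol_self_maps_comp gD(1,2) dD(1,2) L)+
qed

theorem theoremA:
  fixes f :: "nat \<Rightarrow> complex \<Rightarrow> complex"
  assumes "\<forall>n\<ge>1. f n \<in> hol_self_maps"
  shows
    "(\<exists>\<gamma> h. (\<forall>n\<ge>1. \<gamma> n \<in> disc_automorphisms) \<and> h \<in> hol_self_maps \<and>
        converges_on_compacts (\<lambda>n. inv_into \<D> (\<gamma> n) \<circ> left_ifs f n) h)
     \<and>
     (\<forall>\<gamma> \<delta> h k.
        (\<forall>n\<ge>1. \<gamma> n \<in> disc_automorphisms) \<and> (\<forall>n\<ge>1. \<delta> n \<in> disc_automorphisms) \<and>
        h \<in> hol_self_maps \<and> k \<in> hol_self_maps \<and>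
        converges_on_compacts (\<lambda>n. inv_into \<D> (\<gamma> n) \<circ> left_ifs f n) h \<and>
        converges_on_compacts (\<lambda>n. inv_into \<D> (\<delta> n) \<circ> left_ifs f n) k
        \<longrightarrow> (\<exists>\<phi>\<in>disc_automorphisms. \<forall>z\<in>\<D>. h z = \<phi> (k z)))"
proof (rule conjI; (intro allI impI; elim conjE)?)
  show "\<exists>\<gamma> h. (\<forall>n\<ge>1. \<gamma> n \<in> disc_automorphisms) \<and> h \<in> hol_self_maps \<and>
      converges_on_compacts (\<lambda>n. inv_into \<D> (\<gamma> n) \<circ> left_ifs f n) h"
    by (rule left_ifs_normalisable[OF assms]) blast
next
  fix \<gamma> \<delta> h k
  assume "\<forall>n\<ge>1. \<gamma> n \<in> disc_automorphisms" "\<forall>n\<ge>1. \<delta> n \<in> disc_automorphisms"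
    "h \<in> hol_self_maps" "k \<in> hol_self_maps"
    "converges_on_compacts (\<lambda>n. inv_into \<D> (\<gamma> n) \<circ> left_ifs f n) h"
    "converges_on_compacts (\<lambda>n. inv_into \<D> (\<delta> n) \<circ> left_ifs f n) k"
  then show "\<exists>\<phi>\<in>disc_automorphisms. \<forall>z\<in>\<D>. h z = \<phi> (k z)"
    by (rule left_ifs_limit_unique[OF assms]) blast
qed

end
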